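(* If $n=2^s+2$ for some integer $s>0$, then $$\Delta_4(n)\le \Delta_4'(n) \le \frac{1}{2^{s-1}} = \frac{2}{n-2}.$$
   Context: For an integer $k\ge 3$, an integer $n\ge k$ and a set $\mathcal{P}$ of $n$ points in the unit square $[0,1]^2$, let $\mathcal{A}_k(\mathcal{P})$ be the minimum, over all $k$-element subsets of $\mathcal{P}$, of the area of the convex hull of that subset; $\Delta_k(n)$ is the supremum of $\mathcal{A}_k(\mathcal{P})$ over all $n$-point sets $\mathcal{P}\subset[0,1]^2$. Similarly, for $0<d\le 1$ and a set $\mathcal{P}$ of $n$ points in the rectangle $[0,d]\times[0,d^{-1}]$ (of area $1$), let $\mathcal{A}'_k(\mathcal{P})$ be the minimum area of the convex hull of a $k$-element subset of $\mathcal{P}$, and let $\Delta_k'(n)$ be the supremum of $\mathcal{A}'_k(\mathcal{P})$ over all $0<d\le1$ and all $n$-point sets $\mathcal{P}\subset[0,d]\times[0,d^{-1}]$. *)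

theory Defs
  imports "HOL-Analysis.Analysis"
begin

text \<open>
  The family of \<open>k\<close>-subsets below is finite and nonempty, so that the minimum is meaningful,
  whenever \<open>P\<close> is finite with at least \<open>k\<close> points.
\<close>
definition min_hull_area :: "nat \<Rightarrow> (real \<times> real) set \<Rightarrow> real" where
  "min_hull_area k P =
     Min ((\<lambda>T. measure lborel (convex hull T)) ` {T. T \<subseteq> P \<and> card T = k})"

text \<open>
  For \<open>3 \<le> k \<le> n\<close> the two suprema are taken over nonempty sets of reals bounded above by \<open>1\<close>,
  the area of the enclosing rectangle, so the real-valued supremum is the genuine one.
\<close>
definition Heilbronn_square :: "nat \<Rightarrow> nat \<Rightarrow> real" where
  "Heilbronn_square k n =
     Sup {min_hull_area k P | P. P \<subseteq> {0..1} \<times> {0..1} \<and> finite P \<and> card P = n}"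

definition Heilbronn_rect :: "nat \<Rightarrow> nat \<Rightarrow> real" where
  "Heilbronn_rect k n =
     Sup {min_hull_area k P | d P.
            0 < d \<and> d \<le> 1 \<and> P \<subseteq> {0..d} \<times> {0..inverse d} \<and> finite P \<and> card P = n}"

end

theory Submission
  imports Defs
begin

text \<open>
  Take the lexicographically least point \<open>p\<close> of a set of \<open>2 * m + 2\<close> points, and the median \<open>q\<close> of
  the others in the angular order around \<open>p\<close>. Either closed side of the line \<open>pq\<close> contains
  at least \<open>m + 2\<close> of the points (possibly collinear ones included), and one of the sides cuts off
  at most half of the area of any compact convex region containing the points. Starting with
  \<open>2 ^ s + 2\<close> points in a region of area \<open>1\<close>, after \<open>s - 1\<close> halvings there remain four points in a
  convex region of area at most \<open>1 / 2 ^ (s - 1)\<close>.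
\<close>

text \<open>Take the entry at index \<open>m\<close> of the list sorted by \<open>f\<close>: the
  indices \<open>0..m\<close> and \<open>m..2 * m\<close> both include it, so each side counts
  \<open>m + 1\<close> entries. Ties only enlarge the two sets, so \<open>f\<close> may take equal
  values, as happens for points collinear with \<open>p\<close>.\<close>

lemma exists_median:
  fixes f :: "'a \<Rightarrow> 'b::linorder"
  assumes "finite Q" and "card Q = 2 * m + 1"
  obtains q where "q \<in> Q" "m + 1 \<le> card {r \<in> Q. f r \<le> f q}" "m + 1 \<le> card {r \<in> Q. f q \<le> f r}"
proof -
  obtain ys where ys: "set ys = Q" "distinct ys"
    using assms finite_distinct_list by blast
  define xs where "xs = sort_key f ys"
  have xs: "set xs = Q" "distinct xs" "sorted (map f xs)"
    using ys by (auto simp: xs_def)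
  have len: "length xs = 2 * m + 1"
    using xs assms distinct_card by fastforce
  have le: "f (xs ! i) \<le> f (xs ! j)" if "i \<le> j" "j < length xs" for i j
    using sorted_nth_mono[OF xs(3), of i j] that by simp
  have card_nth: "card ((!) xs ` I) = card I" if "I \<subseteq> {..<length xs}" for I
    using that xs(2) by (intro card_image inj_on_nth) auto
  show ?thesis
  proof
    show "xs ! m \<in> Q"
      using xs len by auto
    have "card ((!) xs ` {..m}) \<le> card {r \<in> Q. f r \<le> f (xs ! m)}"
      using assms xs len by (intro card_mono) (auto intro!: le)
    then show "m + 1 \<le> card {r \<in> Q. f r \<le> f (xs ! m)}"
      using card_nth[of "{..m}"] len by (simp add: subset_eq)
    have "card ((!) xs ` {m..2 * m}) \<le> card {r \<in> Q. f (xs ! m) \<le> f r}"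
      using assms xs len by (intro card_mono) (auto intro!: le)
    then show "m + 1 \<le> card {r \<in> Q. f (xs ! m) \<le> f r}"
      using card_nth[of "{m..2 * m}"] len by (simp add: subset_eq)
  qed
qed

text \<open>Seen from such a point, all others lie to the right or vertically above, within a
  half-plane, so their angular order is a linear order by slope.\<close>

lemma exists_lexicographic_least:
  fixes P :: "('a::linorder \<times> 'b::linorder) set"
  assumes "finite P" and "P \<noteq> {}"
  obtains p where "p \<in> P"
    "\<And>r. r \<in> P \<Longrightarrow> fst p < fst r \<or> fst p = fst r \<and> snd p \<le> snd r"
proof -
  define x where "x = Min (fst ` P)"
  define Y where "Y = {y. (x, y) \<in> P}"
  have "x \<in> fst ` P"
    using assms by (simp add: x_def)
  then have "Y \<noteq> {}"
    by (auto simp: Y_def)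
  moreover have "finite Y"
    using finite_imageI[OF assms(1), of snd] by (rule rev_finite_subset) (force simp: Y_def)
  ultimately have Y: "Min Y \<in> Y" "\<And>y. y \<in> Y \<Longrightarrow> Min Y \<le> y"
    by auto
  show ?thesis
  proof
    show "(x, Min Y) \<in> P"
      using Y(1) by (simp add: Y_def)
  next
    fix r assume r: "r \<in> P"
    then have "x \<le> fst r"
      using assms by (simp add: x_def)
    moreover have "Min Y \<le> snd r" if "x = fst r"
      using that r by (intro Y(2)) (simp add: Y_def)
    ultimately show "fst (x, Min Y) < fst r \<or> fst (x, Min Y) = fst r \<and> snd (x, Min Y) \<le> snd r"
      by auto
  qed
qed

lemma exists_halving_line:
  fixes P :: "(real \<times> real) set"
  assumes "finite P" and "card P = 2 * m + 2"
  obtains a b where "a \<noteq> 0" "m + 2 \<le> card {r \<in> P. a \<bullet> r \<le> b}" "m + 2 \<le> card {r \<in> P. a \<bullet> r \<ge> b}"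
proof -
  have "P \<noteq> {}"
    using assms by auto
  then obtain p where p: "p \<in> P"
      "\<And>r. r \<in> P \<Longrightarrow> fst p < fst r \<or> fst p = fst r \<and> snd p \<le> snd r"
    using exists_lexicographic_least[OF assms(1)] by blast
  \<comment> \<open>The vertical direction gets the largest value, since points of \<open>Q\<close>
    with the abscissa of \<open>p\<close> lie above \<open>p\<close>.\<close>
  define slope :: "real \<times> real \<Rightarrow> ereal" where
    "slope r = (if fst r = fst p then \<infinity> else ereal ((snd r - snd p) / (fst r - fst p)))" for r
  define Q where "Q = P - {p}"
  have "finite Q" "card Q = 2 * m + 1"
    using assms p(1) by (auto simp: Q_def)
  then obtain q where q: "q \<in> Q" "m + 1 \<le> card {r \<in> Q. slope r \<le> slope q}"
      "m + 1 \<le> card {r \<in> Q. slope q \<le> slope r}"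
    using exists_median[of Q m slope] by blast
  have after: "fst p < fst r \<or> fst p = fst r \<and> snd p < snd r" if "r \<in> Q" for r
    using p(2)[of r] that by (auto simp: Q_def prod_eq_iff)
  \<comment> \<open>Clear denominators, which are positive by \<open>after\<close> unless a point is
    vertically above \<open>p\<close>. If \<open>r'\<close> is, the left side is 0 and the right
    side is nonnegative; if \<open>r\<close> is, then so is \<open>r'\<close>, and both sides are
    0.\<close>
  have cross: "(snd r - snd p) * (fst r' - fst p) \<le> (snd r' - snd p) * (fst r - fst p)"
    if "r \<in> Q" "r' \<in> Q" "slope r \<le> slope r'" for r r'
    using after[OF that(1)] after[OF that(2)] that(3)
    by (auto simp: slope_def divide_simps split: if_splits)
  \<comment> \<open>This is \<open>q - p\<close> turned by a quarter: the line
    \<open>a \<bullet> r = b\<close> passes through \<open>p\<close> and \<open>q\<close>, and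
    \<open>a \<bullet> r - b\<close> is the cross product of \<open>q - p\<close> and
    \<open>r - p\<close>.\<close>
  define a where "a = (snd p - snd q, fst q - fst p)"
  define b where "b = a \<bullet> p"
  have inner_a: "a \<bullet> r - b = (snd r - snd p) * (fst q - fst p) - (snd q - snd p) * (fst r - fst p)" for r
    by (simp add: a_def b_def inner_prod_def algebra_simps)
  \<comment> \<open>The point \<open>p\<close> lies on the line and so counts on both sides, raising
    the median's \<open>m + 1\<close> to \<open>m + 2\<close>.\<close>
  have card_insert_p: "m + 2 \<le> card S"
    if "m + 1 \<le> card T" "T \<subseteq> Q" "insert p T \<subseteq> S" "S \<subseteq> P" for S T
  proof -
    have fin: "finite T" "finite S" "p \<notin> T"
      using that assms by (auto simp: Q_def intro: finite_subset)
    have "card (insert p T) \<le> card S"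
      using fin that by (intro card_mono)
    then show ?thesis
      using fin that by simp
  qed
  show ?thesis
  proof
    show "a \<noteq> 0"
      using after[OF q(1)] by (auto simp: a_def zero_prod_def)
    show "m + 2 \<le> card {r \<in> P. a \<bullet> r \<le> b}"
    proof (rule card_insert_p[OF q(2)])
      have "a \<bullet> r \<le> b" if "r \<in> Q" "slope r \<le> slope q" for r
        using cross[OF that(1) q(1) that(2)] inner_a[of r] by linarith
      then show "insert p {r \<in> Q. slope r \<le> slope q} \<subseteq> {r \<in> P. a \<bullet> r \<le> b}"
        using p(1) by (auto simp: Q_def b_def)
    qed auto
    show "m + 2 \<le> card {r \<in> P. a \<bullet> r \<ge> b}"
    proof (rule card_insert_p[OF q(3)])
      have "a \<bullet> r \<ge> b" if "r \<in> Q" "slope q \<le> slope r" for r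
        using cross[OF q(1) that] inner_a[of r] by linarith
      then show "insert p {r \<in> Q. slope q \<le> slope r} \<subseteq> {r \<in> P. a \<bullet> r \<ge> b}"
        using p(1) by (auto simp: Q_def b_def)
    qed auto
  qed
qed

text \<open>The two closed pieces overlap only within a hyperplane, a null set.\<close>

lemma measure_split_hyperplane:
  fixes K :: "'a::euclidean_space set"
  assumes "compact K" and "a \<noteq> 0"
  shows "measure lebesgue (K \<inter> {x. a \<bullet> x \<le> b}) + measure lebesgue (K \<inter> {x. a \<bullet> x \<ge> b}) = measure lebesgue K"
proof -
  let ?L = "K \<inter> {x. a \<bullet> x \<le> b}" and ?R = "K \<inter> {x. a \<bullet> x \<ge> b}"
  have "?L \<in> lmeasurable" "?R \<in> lmeasurable"
    using assms(1) by (auto intro!: lmeasurable_compact compact_Int_closed closed_halfspace_le closed_halfspace_ge)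
  then have "measure lebesgue (?L \<union> ?R) = measure lebesgue ?L + measure lebesgue ?R - measure lebesgue (?L \<inter> ?R)"
    by (rule measure_Un3)
  moreover have "?L \<union> ?R = K"
    by auto
  moreover have "measure lebesgue (?L \<inter> ?R) = 0"
  proof (rule negligible_imp_measure0)
    have "negligible {x. a \<bullet> x = b}"
      using assms(2) by (simp add: negligible_hyperplane)
    then show "negligible (?L \<inter> ?R)"
      by (rule negligible_subset) auto
  qed
  ultimately show ?thesis
    by simp
qed

text \<open>Induction on the number of halvings, with \<open>K\<close> arbitrary because it is
  replaced by \<open>K \<inter> H\<close>. The cardinality is only bounded below, since a closed
  side may hold more than \<open>m + 2\<close> points; for \<open>s = 0\<close> the bound is
  4.\<close>

lemma exists_small_quadruple:
  fixes P K :: "(real \<times> real) set"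
  assumes "compact K" "convex K" "P \<subseteq> K" "finite P" "card P \<ge> 2 ^ Suc s + 2"
  shows "\<exists>T \<subseteq> P. card T = 4 \<and> measure lebesgue (convex hull T) \<le> measure lebesgue K / 2 ^ s"
  using assms
proof (induction s arbitrary: P K)
  case 0
  then obtain T where T: "T \<subseteq> P" "card T = 4" "finite T"
    using obtain_subset_with_card_n[of 4 P] by auto
  moreover have "measure lebesgue (convex hull T) \<le> measure lebesgue K"
    using 0 T by (intro measure_mono_fmeasurable hull_minimal)
      (auto intro!: lmeasurable_compact fmeasurableD finite_imp_compact_convex_hull)
  ultimately show ?case
    by auto
next
  case (Suc s)
  \<comment> \<open>Surplus points are dropped because the halving line is found for exactly
    \<open>2 * m + 2\<close> points, here with \<open>m = 2 ^ Suc s\<close>.\<close>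
  obtain P' where P': "P' \<subseteq> P" "card P' = 2 * 2 ^ Suc s + 2" "finite P'"
    using obtain_subset_with_card_n[OF Suc.prems(5)] by auto
  obtain a b where ab: "a \<noteq> 0" "2 ^ Suc s + 2 \<le> card {r \<in> P'. a \<bullet> r \<le> b}"
      "2 ^ Suc s + 2 \<le> card {r \<in> P'. a \<bullet> r \<ge> b}"
    using exists_halving_line[OF P'(3,2)] by blast
  \<comment> \<open>Stated for a general \<open>H\<close> so that it serves whichever side has the
    smaller area.\<close>
  have step: ?case
    if "closed H" "convex H" "2 ^ Suc s + 2 \<le> card (P' \<inter> H)"
      and half: "measure lebesgue (K \<inter> H) \<le> measure lebesgue K / 2" for H
  proof -
    have "compact (K \<inter> H)" "convex (K \<inter> H)" "P' \<inter> H \<subseteq> K \<inter> H" "finite (P' \<inter> H)"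
      using Suc.prems P' that by (auto intro: convex_Int compact_Int_closed)
    from Suc.IH[OF this that(3)] obtain T where
      T: "T \<subseteq> P' \<inter> H" "card T = 4" "measure lebesgue (convex hull T) \<le> measure lebesgue (K \<inter> H) / 2 ^ s"
      by blast
    have "measure lebesgue (K \<inter> H) / 2 ^ s \<le> measure lebesgue K / 2 ^ Suc s"
      using half by (simp add: field_simps)
    with T P'(1) show ?thesis
      by (intro exI[of _ T]) auto
  qed
  have "measure lebesgue (K \<inter> {x. a \<bullet> x \<le> b}) \<le> measure lebesgue K / 2 \<or>
      measure lebesgue (K \<inter> {x. a \<bullet> x \<ge> b}) \<le> measure lebesgue K / 2"
    using measure_split_hyperplane[OF Suc.prems(1) ab(1), of b] by linarith
  then show ?case
    using step[of "{x. a \<bullet> x \<le> b}"] step[of "{x. a \<bullet> x \<ge> b}"] ab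
    by (auto simp: Int_def closed_halfspace_le closed_halfspace_ge convex_halfspace_le convex_halfspace_ge)
qed

lemma min_hull_area_le:
  assumes "finite P" "T \<subseteq> P" "card T = k"
  shows "min_hull_area k P \<le> measure lborel (convex hull T)"
  unfolding min_hull_area_def
proof (rule Min_le)
  have "finite {T. T \<subseteq> P \<and> card T = k}"
    using assms(1) by (auto intro: finite_subset[of _ "Pow P"])
  then show "finite ((\<lambda>T. measure lborel (convex hull T)) ` {T. T \<subseteq> P \<and> card T = k})"
    by simp
qed (use assms in auto)

lemma min_hull_area_rect_le:
  assumes "s > 0" "0 < d" "P \<subseteq> {0..d} \<times> {0..inverse d}" "finite P" "card P = 2 ^ s + 2"
  shows "min_hull_area 4 P \<le> 1 / 2 ^ (s - 1)"
proof -
  let ?K = "cbox (0, 0) (d, inverse d)"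
  have s: "s = Suc (s - 1)"
    using assms(1) by simp
  have K: "{0..d} \<times> {0..inverse d} = ?K"
    by (simp add: cbox_Pair_eq)
  have "measure lebesgue ?K = 1"
    using assms(2) by (simp add: content_Pair)
  then obtain T where T: "T \<subseteq> P" "card T = 4" "measure lebesgue (convex hull T) \<le> 1 / 2 ^ (s - 1)"
    using exists_small_quadruple[of ?K P "s - 1"] assms K s by (auto simp: convex_box)
  \<comment> \<open>Compact sets are Borel, and on Borel sets \<open>lebesgue\<close> and
    \<open>lborel\<close> agree.\<close>
  have "compact (convex hull T)"
    using T assms(4) by (intro finite_imp_compact_convex_hull) (rule finite_subset)
  then have "measure lebesgue (convex hull T) = measure lborel (convex hull T)"
    by (simp add: borel_compact)
  then show ?thesis
    using min_hull_area_le[OF assms(4) T(1,2)] T(3) by simp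
qed

theorem theorem3:
  fixes n s :: nat
  assumes "s > 0" and "n = 2 ^ s + 2"
  shows "Heilbronn_square 4 n \<le> Heilbronn_rect 4 n
    \<and> Heilbronn_rect 4 n \<le> 1 / 2 ^ (s - 1)
    \<and> (1 / 2 ^ (s - 1) :: real) = 2 / (real n - 2)"
proof -
  let ?S = "{min_hull_area 4 P | P. P \<subseteq> {0..1} \<times> {0..1} \<and> finite P \<and> card P = n}"
  let ?R = "{min_hull_area 4 P | d P.
    0 < d \<and> d \<le> 1 \<and> P \<subseteq> {0..d} \<times> {0..inverse d} \<and> finite P \<and> card P = n}"
  \<comment> \<open>The real-valued \<open>Sup\<close> is meaningful only on nonempty sets, so some
    \<open>n\<close>-point set must exist in the square.\<close>
  have "infinite ({0..1::real} \<times> {0..1::real})"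
    by (simp add: finite_cartesian_product_iff infinite_Icc)
  then obtain P :: "(real \<times> real) set" where "P \<subseteq> {0..1} \<times> {0..1}" "finite P" "card P = n"
    using infinite_arbitrarily_large by blast
  then have ne: "?S \<noteq> {}"
    by blast
  \<comment> \<open>The unit square is the rectangle with \<open>d = 1\<close>.\<close>
  have sub: "?S \<subseteq> ?R"
    by (force intro: exI[of _ 1])
  have le: "x \<le> 1 / 2 ^ (s - 1)" if "x \<in> ?R" for x
    using that min_hull_area_rect_le[OF assms(1)] assms(2) by blast
  then have "bdd_above ?R"
    by (rule bdd_aboveI)
  then have "Heilbronn_square 4 n \<le> Heilbronn_rect 4 n"
    unfolding Heilbronn_square_def Heilbronn_rect_def using ne sub by (intro cSup_subset_mono)
  moreover have "Heilbronn_rect 4 n \<le> 1 / 2 ^ (s - 1)"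
    unfolding Heilbronn_rect_def using ne sub le by (intro cSup_least) blast+
  moreover have "(1 / 2 ^ (s - 1) :: real) = 2 / (real n - 2)"
    using assms by (cases s) auto
  ultimately show ?thesis
    by blast
qed

end
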